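(* Let $$C(x,y)=\sum_{\pi\in\mathcal{F}}x^{|\pi|}y^{\mathrm{trun}(\pi)-1}p^{\#112(\pi)}q^{\#121(\pi)}r^{\#221(\pi)}$$ be the generating function that enumerates the members of $\mathcal{F}$ jointly according to length, $\mathrm{trun}-1$, $\#112$, $\#121$ and $\#221$ (marked by $x$, $y$, $p$, $q$ and $r$, respectively). Then $$C(x,y)=\frac{x\left(1-2x-(p-1)x^2\right)^2}{\left(1-x(1+y)-(p-1)x^2y\right)\alpha},$$ where $$\alpha=1-4x-(2p+q-6)x^2+(4p+3q-r-pq-5)x^3+(p-1)(p+3q-r-3)x^4+(p-1)^2(q-1)x^5.$$
   Context: A Catalan word of length $n\geq 1$ is an integer sequence $\pi=\pi_1\cdots\pi_n$ with $\pi_1=1$ and $1\leq \pi_{i+1}\leq \pi_i+1$ for $1\leq i\leq n-1$. A (weakly) increasing run of a word is a maximal nondecreasing string of consecutive letters. A Catalan word is flattened if the sequence of first letters of its increasing runs, read from left to right, is nondecreasing. $\mathcal{F}_n$ is the set of flattened Catalan words of length $n$, $\mathcal{F}=\cup_{n\geq 1}\mathcal{F}_n$, and $|\pi|$ is the length of $\pi$. For a word $w$, $\mathrm{trun}(w)$ is the number of distinct letters appearing in the rightmost increasing run of $w$. For a pattern $\tau=\tau_1\cdots\tau_m$, $\#\tau(\pi)$ is the number of occurrences of $\tau$ in $\pi$ as a consecutive (subword) pattern, i.e., the number of indices $i$ such that $\pi_i\pi_{i+1}\cdots\pi_{i+m-1}$ is order-isomorphic to $\tau$. Here $x,y,p,q,r$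 are indeterminates and generating functions are formal power series in $x$ with coefficients polynomial in $y,p,q,r$. *)

theory Defs
  imports "HOL-Computational_Algebra.Computational_Algebra"
begin

definition catalan_word :: "nat list \<Rightarrow> bool" where
  "catalan_word w \<longleftrightarrow>
     w \<noteq> [] \<and> hd w = 1 \<and> (\<forall>i. Suc i < length w \<longrightarrow> 1 \<le> w ! Suc i \<and> w ! Suc i \<le> w ! i + 1)"

fun incr_runs :: "nat list \<Rightarrow> nat list list" where
  "incr_runs [] = []"
| "incr_runs [a] = [[a]]"
| "incr_runs (a # b # w) =
     (if a \<le> b then (a # hd (incr_runs (b # w))) # tl (incr_runs (b # w))
      else [a] # incr_runs (b # w))"

text \<open>The next lemmas characterise \<open>incr_runs w\<close>: it cuts \<open>w\<close> into nonempty nondecreasing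
  factors, and these are maximal, since there is a descent between any two neighbouring factors.\<close>

lemma incr_runs_eq_Nil_iff [simp]: "incr_runs w = [] \<longleftrightarrow> w = []"
  by (induction w rule: incr_runs.induct) auto

lemma hd_hd_incr_runs: "w \<noteq> [] \<Longrightarrow> hd (incr_runs w) \<noteq> [] \<and> hd (hd (incr_runs w)) = hd w"
  by (induction w rule: incr_runs.induct) auto

lemma concat_incr_runs: "concat (incr_runs w) = w"
proof (induction w rule: incr_runs.induct)
  case (3 a b w)
  then show ?case by (cases "incr_runs (b # w)") (auto split: if_splits)
qed auto

lemma incr_runs_sorted: "u \<in> set (incr_runs w) \<Longrightarrow> u \<noteq> [] \<and> sorted u"
proof (induction w arbitrary: u rule: incr_runs.induct)
  case (3 a b w)
  show ?case
  proof (cases "a \<le> b")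
    case True
    obtain v vs where v: "incr_runs (b # w) = v # vs"
      by (cases "incr_runs (b # w)") auto
    have "v \<noteq> []" "hd v = b" "sorted v"
      using hd_hd_incr_runs[of "b # w"] "3.IH"(1)[of v] v True by auto
    then have "sorted (a # v)"
      using True by (cases v) auto
    then show ?thesis
      using "3.prems" "3.IH"(1)[of u] v True by auto
  next
    case False
    then show ?thesis using 3 by auto
  qed
qed auto

lemma incr_runs_descents: "successively (\<lambda>u v. hd v < last u) (incr_runs w)"
proof (induction w rule: incr_runs.induct)
  case (3 a b w)
  obtain v vs where v: "incr_runs (b # w) = v # vs"
    by (cases "incr_runs (b # w)") auto
  have "v \<noteq> []" "hd v = b"
    using hd_hd_incr_runs[of "b # w"] v by auto
  then show ?case using 3 v by (cases vs) (auto split: if_splits)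
qed auto

definition flattened :: "nat list \<Rightarrow> bool" where
  "flattened w \<longleftrightarrow> sorted (map hd (incr_runs w))"

definition flattened_catalan_words :: "nat list set" where
  "flattened_catalan_words = {w. catalan_word w \<and> flattened w}"

definition trun :: "nat list \<Rightarrow> nat" where
  "trun w = card (set (last (incr_runs w)))"

definition order_isomorphic :: "nat list \<Rightarrow> nat list \<Rightarrow> bool" where
  "order_isomorphic u v \<longleftrightarrow>
     length u = length v \<and> (\<forall>i<length u. \<forall>j<length u. u ! i < u ! j \<longleftrightarrow> v ! i < v ! j)"

definition subword_occ :: "nat list \<Rightarrow> nat list \<Rightarrow> nat" where
  "subword_occ \<tau> w =
     card {i. i + length \<tau> \<le> length w \<and> order_isomorphic (take (length \<tau>) (drop i w)) \<tau>}"

text \<open>The polynomial ring in the four indeterminates \<open>y\<close>, \<open>p\<close>, \<open>q\<close>, \<open>r\<close> over the integers,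
  as the iterated univariate ring $\mathbb{Z}[r][q][p][y]$.\<close>

type_synonym ypqr_poly = "int poly poly poly poly"

definition var_y :: ypqr_poly where "var_y = [:0, 1:]"
definition var_p :: ypqr_poly where "var_p = [:[:0, 1:]:]"
definition var_q :: ypqr_poly where "var_q = [:[:[:0, 1:]:]:]"
definition var_r :: ypqr_poly where "var_r = [:[:[:[:0, 1:]:]:]:]"

definition word_weight :: "nat list \<Rightarrow> ypqr_poly" where
  "word_weight w =
     var_y ^ (trun w - 1) * var_p ^ subword_occ [1,1,2] w * var_q ^ subword_occ [1,2,1] w
       * var_r ^ subword_occ [2,2,1] w"

text \<open>The coefficients of the generating function are polynomials; they are embedded into the
  fraction field only so that quotients of power series can be written with \<open>/\<close>.\<close>

definition catalan_gf :: "ypqr_poly fract fps" where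
  "catalan_gf =
     Abs_fps (\<lambda>n. to_fract (\<Sum>w | w \<in> flattened_catalan_words \<and> length w = n. word_weight w))"

text \<open>The sums in \<open>catalan_gf\<close> range over finite sets.\<close>

lemma catalan_word_nth_le:
  assumes "catalan_word w" "i < length w"
  shows "w ! i \<le> Suc i"
  using assms(2)
proof (induction i)
  case 0
  then show ?case using assms(1) by (auto simp: catalan_word_def hd_conv_nth)
next
  case (Suc i)
  then show ?case using assms(1) by (fastforce simp: catalan_word_def)
qed

lemma finite_flattened_catalan_words: "finite {w \<in> flattened_catalan_words. length w = n}"
proof (rule finite_subset)
  show "{w \<in> flattened_catalan_words. length w = n} \<subseteq> {w. set w \<subseteq> {..n} \<and> length w = n}"
    using catalan_word_nth_le
    by (fastforce simp: flattened_catalan_words_def in_set_conv_nth)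
qed (simp add: finite_lists_length_eq)

end

theory Submission
  imports Defs
begin

text \<open>
  Build a word letter by letter from the left. Let \<open>s\<close> be the first and \<open>a\<close> the last letter of the
  rightmost run of a flattened Catalan word \<open>w\<close>. Letters grow by at most one within a run, so the run
  uses exactly the letters from \<open>s\<close> to \<open>a\<close>, and \<open>trun w - 1\<close> is \<open>t = a - s\<close> (\<open>trun_minus_1\<close>).
  A new letter \<open>b\<close> keeps the word Catalan iff \<open>1 \<le> b \<le> a + 1\<close>, and keeps it flattened iff \<open>s \<le> b\<close>:
  a smaller letter would open a run with a smaller head. Hence the children of \<open>w\<close> are \<open>w b\<close> with
  \<open>s \<le> b \<le> a + 1\<close> (\<open>words_Suc\<close>), namely one rise (\<open>t\<close> becomes \<open>t + 1\<close>), one plateau (\<open>t\<close> stays) and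
  \<open>t\<close> descents (\<open>t\<close> becomes \<open>0\<close>).

  Which of the three patterns the new letter completes depends only on the kind of the step before
  it: a rise after a plateau completes 112, a descent after a plateau completes 221, and of the \<open>t\<close>
  descents after a rise exactly the one to \<open>a - 1\<close> completes 121. A word whose last step is a descent,
  or which has a single letter, has \<open>t = 0\<close> and so admits no descent.

  Let \<open>A[f]\<close>, \<open>L[f]\<close>, \<open>D[f]\<close> be the generating functions, with an extra factor \<open>f t\<close> on each word, of the
  words ending in a rise, ending in a plateau, and of the remaining ones. By the above,
  \[ A[f] = x (A[f'] + p L[f'] + D[f']), \qquad L[f] = x (A[f] + L[f] + D[f]), \]
  \[ D[f] = f(0) x (1 + A[t - 1 + q] + r L[t]), \]
  where $f'(t) = f(t + 1)$. The choices \<open>f = 1\<close> and \<open>f = t\<close> give a closed linear system, which determines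
  \<open>D[1]\<close> (\<open>restart_gf\<close>); then \<open>f = y ^ t\<close> gives \<open>C(x,y)\<close> as a rational multiple of \<open>D[1]\<close> (\<open>total_gf\<close>).
  Carrying a general \<open>f\<close> replaces the derivative in \<open>y\<close> at \<open>y = 1\<close> that the count of descents would
  otherwise call for.
\<close>

section \<open>Extending a word by one letter\<close>

lemma incr_runs_snoc:
  assumes "w \<noteq> []"
  shows "incr_runs (w @ [b]) =
    (if last w \<le> b then butlast (incr_runs w) @ [last (incr_runs w) @ [b]]
     else incr_runs w @ [[b]])"
  using assms
proof (induction w rule: incr_runs.induct)
  case (3 a c w)
  obtain v vs where v: "incr_runs (c # w) = v # vs"
    by (cases "incr_runs (c # w)") auto
  show ?case
    using 3 v by (cases vs) auto
qed auto

definition run_start :: "nat list \<Rightarrow> nat" where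
  "run_start w = hd (last (incr_runs w))"

lemma run_start_singleton [simp]: "run_start [a] = a"
  by (simp add: run_start_def)

lemma run_start_snoc:
  assumes "w \<noteq> []"
  shows "run_start (w @ [b]) = (if last w \<le> b then run_start w else b)"
proof -
  have "last (incr_runs w) \<noteq> []"
    using assms incr_runs_sorted[of "last (incr_runs w)" w] by simp
  then show ?thesis
    using assms by (simp add: run_start_def incr_runs_snoc)
qed

text \<open>The condition on neighbouring letters of \<open>w @ [b]\<close> is the one for \<open>w\<close> plus the one at the new
  last position.\<close>

lemma catalan_word_snoc:
  assumes "w \<noteq> []"
  shows "catalan_word (w @ [b]) \<longleftrightarrow> catalan_word w \<and> 1 \<le> b \<and> b \<le> Suc (last w)"
proof -
  define n where "n = length w"
  have n: "n > 0" "last w = w ! (n - 1)"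
    using assms by (auto simp: n_def last_conv_nth)
  have *: "Suc i < length (w @ [b]) \<longleftrightarrow> Suc i < n \<or> i = n - 1" for i
    using n by (auto simp: n_def)
  have "(\<forall>i. Suc i < length (w @ [b]) \<longrightarrow>
            1 \<le> (w @ [b]) ! Suc i \<and> (w @ [b]) ! Suc i \<le> (w @ [b]) ! i + 1) \<longleftrightarrow>
        (\<forall>i. Suc i < n \<longrightarrow> 1 \<le> w ! Suc i \<and> w ! Suc i \<le> w ! i + 1) \<and> 1 \<le> b \<and> b \<le> Suc (last w)"
    unfolding * using n by (auto simp: nth_append n_def[symmetric])
  then show ?thesis
    using assms by (simp add: catalan_word_def n_def)
qed

lemma catalan_word_singleton [simp]: "catalan_word [a] \<longleftrightarrow> a = 1"
  by (auto simp: catalan_word_def)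

lemma catalan_word_not_Nil: "catalan_word w \<Longrightarrow> w \<noteq> []"
  by (simp add: catalan_word_def)

lemma run_start_le_last:
  assumes "w \<noteq> []"
  shows "run_start w \<le> last w"
  using assms
proof (induction w rule: rev_induct)
  case (snoc b w)
  then show ?case by (cases "w = []") (auto simp: run_start_snoc)
qed simp

lemma run_start_ge_1:
  assumes "catalan_word w"
  shows "1 \<le> run_start w"
  using assms
proof (induction w rule: rev_induct)
  case (snoc b w)
  then show ?case
    by (cases "w = []") (auto simp: run_start_snoc catalan_word_snoc)
qed (simp add: catalan_word_def)

text \<open>Within a run a Catalan word climbs by steps of at most one, so it skips no letter.\<close>

lemma set_last_run:
  assumes "catalan_word w"
  shows "set (last (incr_runs w)) = {run_start w..last w}"
  using assms
proof (induction w rule: rev_induct)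
  case (snoc b w)
  show ?case
  proof (cases "w = []")
    case False
    then show ?thesis
      using snoc run_start_le_last[of w]
      by (auto simp: catalan_word_snoc run_start_snoc incr_runs_snoc)
  qed simp
qed (simp add: catalan_word_def)

definition excess :: "nat list \<Rightarrow> nat" where
  "excess w = last w - run_start w"

lemma trun_minus_1: "catalan_word w \<Longrightarrow> trun w - 1 = excess w"
  by (simp add: trun_def set_last_run excess_def)

text \<open>A letter \<open>b \<ge> last w\<close> creates no new run head and satisfies \<open>run_start w \<le> b\<close> anyway; a smaller
  one appends \<open>b\<close> to the sorted list of heads, whose last entry is \<open>run_start w\<close>.\<close>

lemma flattened_snoc:
  assumes "w \<noteq> []"
  shows "flattened (w @ [b]) \<longleftrightarrow> flattened w \<and> run_start w \<le> b"
proof -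
  define us u where "us = butlast (incr_runs w)" and "u = last (incr_runs w)"
  have runs: "incr_runs w = us @ [u]"
    using assms by (simp add: us_def u_def)
  have "u \<noteq> []"
    using incr_runs_sorted[of u w] runs by simp
  then show ?thesis
    using run_start_le_last[OF assms] assms
    by (auto simp: flattened_def incr_runs_snoc runs sorted_append run_start_def)
qed

section \<open>The tree of flattened Catalan words\<close>

definition words :: "nat \<Rightarrow> nat list set" where
  "words n = {w \<in> flattened_catalan_words. length w = n}"

lemma words_0: "words 0 = {}"
  by (auto simp: words_def flattened_catalan_words_def catalan_word_def)

lemma words_1: "words 1 = {[1]}"
  by (auto simp: words_def flattened_catalan_words_def length_Suc_conv flattened_def)

lemma words_Suc:
  assumes "n > 0"
  shows "words (Suc n) = (\<lambda>(w, b). w @ [b]) ` (SIGMA w:words n. {run_start w..Suc (last w)})"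
proof (intro set_eqI iffI)
  fix v assume v: "v \<in> words (Suc n)"
  then have len: "length v = Suc n"
    by (simp add: words_def)
  then obtain w b where vw: "v = w @ [b]"
    by (metis length_Suc_conv_rev)
  have "w \<noteq> []"
    using vw len assms by auto
  then show "v \<in> (\<lambda>(w, b). w @ [b]) ` (SIGMA w:words n. {run_start w..Suc (last w)})"
    using v vw len
    by (force simp: words_def flattened_catalan_words_def catalan_word_snoc flattened_snoc)
next
  fix v assume "v \<in> (\<lambda>(w, b). w @ [b]) ` (SIGMA w:words n. {run_start w..Suc (last w)})"
  then obtain w b where v: "v = w @ [b]" "w \<in> words n" "b \<in> {run_start w..Suc (last w)}"
    by auto
  then have "catalan_word w"
    by (simp add: words_def flattened_catalan_words_def)
  then show "v \<in> words (Suc n)"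
    using v catalan_word_not_Nil[of w] run_start_ge_1[of w]
    by (auto simp: words_def flattened_catalan_words_def catalan_word_snoc flattened_snoc)
qed

lemma sum_words_Suc:
  assumes "n > 0"
  shows "(\<Sum>v\<in>words (Suc n). g v) =
    (\<Sum>w\<in>words n. g (w @ [Suc (last w)]) + g (w @ [last w])
      + (\<Sum>b\<in>{run_start w..<last w}. g (w @ [b])))"
proof -
  have split: "(\<Sum>b\<in>{s..Suc a}. h b) = h (Suc a) + h a + (\<Sum>b\<in>{s..<a}. h b)"
    if "s \<le> a" for s a :: nat and h :: "nat \<Rightarrow> 'a"
  proof -
    have "{s..Suc a} = insert (Suc a) (insert a {s..<a})"
      using that by auto
    then show ?thesis by (simp add: add.assoc)
  qed
  have "finite (words n)"
    unfolding words_def by (rule finite_flattened_catalan_words)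
  then have "(\<Sum>v\<in>words (Suc n). g v) = (\<Sum>w\<in>words n. \<Sum>b\<in>{run_start w..Suc (last w)}. g (w @ [b]))"
    unfolding words_Suc[OF assms]
    by (subst sum.reindex, force simp: inj_on_def, subst sum.Sigma)
      (auto simp: case_prod_unfold simp del: sum.cl_ivl_Suc)
  also have "\<dots> = (\<Sum>w\<in>words n. g (w @ [Suc (last w)]) + g (w @ [last w])
      + (\<Sum>b\<in>{run_start w..<last w}. g (w @ [b])))"
    using catalan_word_not_Nil run_start_le_last
    by (intro sum.cong refl split) (auto simp: words_def flattened_catalan_words_def)
  finally show ?thesis .
qed

text \<open>\<open>Restart\<close> covers descents and also one-letter words: in both cases the last letter opens a run.\<close>

datatype step = Rise | Plateau | Restart

definition last_step :: "nat list \<Rightarrow> step" where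
  "last_step w =
     (if butlast w \<noteq> [] \<and> last (butlast w) < last w then Rise
      else if butlast w \<noteq> [] \<and> last (butlast w) = last w then Plateau
      else Restart)"

lemma last_step_snoc:
  assumes "w \<noteq> []"
  shows "last_step (w @ [b]) = (if last w < b then Rise else if last w = b then Plateau else Restart)"
  using assms by (auto simp: last_step_def)

text \<open>A rise in a Catalan word is by exactly one, so the only descent after it that returns to the
  letter before the rise is the one by one.\<close>

lemma last_step_Rise:
  assumes "catalan_word w" "last_step w = Rise"
  shows "run_start w < last w" "last (butlast w) = last w - 1"
proof -
  obtain u c where w: "w = u @ [c]" "u \<noteq> []" "last u < c"
    using assms by (cases w rule: rev_cases) (auto simp: last_step_def split: if_splits)
  then have "c = Suc (last u)"
    using assms(1) by (simp add: catalan_word_snoc)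
  then show "run_start w < last w" "last (butlast w) = last w - 1"
    using w run_start_le_last[of u] by (auto simp: run_start_snoc)
qed

lemma last_step_Restart:
  assumes "w \<noteq> []" "last_step w = Restart"
  shows "run_start w = last w"
proof -
  obtain u c where w: "w = u @ [c]"
    using assms(1) by (cases w rule: rev_cases) auto
  then show ?thesis
    using assms(2) by (cases "u = []") (auto simp: run_start_snoc last_step_snoc split: if_splits)
qed

section \<open>Pattern counts\<close>

text \<open>The only window of \<open>w @ [b]\<close> that is not already one of \<open>w\<close> is the suffix of the length of the
  pattern.\<close>

lemma subword_occ_snoc:
  assumes "\<tau> \<noteq> []"
  shows "subword_occ \<tau> (w @ [b]) = subword_occ \<tau> w +
    of_bool (length \<tau> \<le> Suc (length w) \<and>
      order_isomorphic (drop (Suc (length w) - length \<tau>) (w @ [b])) \<tau>)"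
proof -
  define m n where "m = length \<tau>" and "n = length w"
  have "m > 0"
    using assms by (simp add: m_def)
  define occ where "occ v = {i. i + m \<le> length v \<and> order_isomorphic (take m (drop i v)) \<tau>}" for v
  have fin: "finite (occ w)"
    by (rule finite_subset[of _ "{..length w}"]) (auto simp: occ_def)
  have old: "i \<in> occ (w @ [b]) \<longleftrightarrow> i \<in> occ w" if "i + m \<le> n" for i
    using that by (simp add: occ_def n_def)
  have new: "i \<in> occ (w @ [b]) \<longleftrightarrow>
      i = Suc n - m \<and> m \<le> Suc n \<and> order_isomorphic (drop (Suc n - m) (w @ [b])) \<tau>"
    if "\<not> i + m \<le> n" for i
  proof -
    have "i + m \<le> Suc n \<longleftrightarrow> i = Suc n - m \<and> m \<le> Suc n"
      using that by linarith
    then show ?thesis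
      by (auto simp: occ_def n_def)
  qed
  have "occ (w @ [b]) = (if m \<le> Suc n \<and> order_isomorphic (drop (Suc n - m) (w @ [b])) \<tau>
      then insert (Suc n - m) (occ w) else occ w)"
  proof (intro set_eqI)
    fix i
    have "i \<notin> occ w" if "\<not> i + m \<le> n"
      using that by (simp add: occ_def n_def)
    then show "i \<in> occ (w @ [b]) \<longleftrightarrow> i \<in> (if m \<le> Suc n \<and> order_isomorphic (drop (Suc n - m) (w @ [b])) \<tau>
      then insert (Suc n - m) (occ w) else occ w)"
      using old[of i] new[of i] \<open>m > 0\<close> by (cases "i + m \<le> n") auto
  qed
  moreover have "Suc n - m \<notin> occ w" if "m \<le> Suc n"
    using that by (auto simp: occ_def n_def)
  ultimately have "card (occ (w @ [b])) = card (occ w) +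
      of_bool (m \<le> Suc n \<and> order_isomorphic (drop (Suc n - m) (w @ [b])) \<tau>)"
    using fin by auto
  then show ?thesis
    by (simp add: subword_occ_def occ_def m_def n_def)
qed

lemma subword_occ_3_snoc:
  assumes "length \<tau> = 3" "w \<noteq> []"
  shows "subword_occ \<tau> (w @ [b]) = subword_occ \<tau> w +
    of_bool (butlast w \<noteq> [] \<and> order_isomorphic [last (butlast w), last w, b] \<tau>)"
proof -
  have "\<tau> \<noteq> []"
    using assms(1) by auto
  obtain u c where w: "w = u @ [c]"
    using assms(2) by (cases w rule: rev_cases) auto
  show ?thesis
  proof (cases u rule: rev_cases)
    case Nil
    then show ?thesis
      using assms(1) w subword_occ_snoc[OF \<open>\<tau> \<noteq> []\<close>, of w b] by simp
  next
    case (snoc t d)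
    then show ?thesis
      using assms(1) w subword_occ_snoc[OF \<open>\<tau> \<noteq> []\<close>, of w b] by (simp add: butlast_append)
  qed
qed

lemma order_isomorphic_3:
  "order_isomorphic [a, b, c] [1, 1, 2] \<longleftrightarrow> a = b \<and> b < c"
  "order_isomorphic [a, b, c] [1, 2, 1] \<longleftrightarrow> a < b \<and> c = a"
  "order_isomorphic [a, b, c] [2, 2, 1] \<longleftrightarrow> a = b \<and> c < b"
  by (auto simp: order_isomorphic_def All_less_Suc numeral_3_eq_3 numeral_2_eq_2)

lemma subword_occ_patterns_snoc:
  assumes "w \<noteq> []"
  shows "subword_occ [1,1,2] (w @ [b]) =
           subword_occ [1,1,2] w + of_bool (last_step w = Plateau \<and> last w < b)"
    and "subword_occ [1,2,1] (w @ [b]) =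
           subword_occ [1,2,1] w + of_bool (last_step w = Rise \<and> b = last (butlast w))"
    and "subword_occ [2,2,1] (w @ [b]) =
           subword_occ [2,2,1] w + of_bool (last_step w = Plateau \<and> b < last w)"
  using assms
  by (auto simp: subword_occ_3_snoc order_isomorphic_3 last_step_def simp del: One_nat_def)

lemma subword_occ_singleton:
  assumes "length \<tau> \<ge> 2"
  shows "subword_occ \<tau> [a] = 0"
  using assms by (simp add: subword_occ_def)

section \<open>Refined generating functions\<close>

context
  fixes p q r :: "'a :: idom"
begin

definition pattern_weight :: "nat list \<Rightarrow> 'a" where
  "pattern_weight w =
     p ^ subword_occ [1,1,2] w * q ^ subword_occ [1,2,1] w * r ^ subword_occ [2,2,1] w"

text \<open>The statistic \<open>f\<close> of the excess is left open because the recurrences for one \<open>f\<close> involve others: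
  a rise shifts the argument of \<open>f\<close>, and the number of descents brings in the excess itself.\<close>

definition step_sum :: "step \<Rightarrow> (nat \<Rightarrow> 'a) \<Rightarrow> nat \<Rightarrow> 'a" where
  "step_sum k f n = (\<Sum>w\<in>words n. if last_step w = k then f (excess w) * pattern_weight w else 0)"

definition step_gf :: "step \<Rightarrow> (nat \<Rightarrow> 'a) \<Rightarrow> 'a fps" where
  "step_gf k f = Abs_fps (step_sum k f)"

lemma step_sum_0: "step_sum k f 0 = 0"
  by (simp add: step_sum_def words_0)

lemma step_sum_1: "step_sum k f (Suc 0) = (if k = Restart then f 0 else 0)"
  using words_1
  by (simp add: step_sum_def last_step_def excess_def pattern_weight_def subword_occ_singleton)

lemma pattern_weight_rise:
  assumes "catalan_word w"
  shows "pattern_weight (w @ [Suc (last w)]) =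
    (if last_step w = Plateau then p else 1) * pattern_weight w"
proof -
  have "Suc (last w) \<noteq> last (butlast w)" if "last_step w = Rise"
    using last_step_Rise[OF assms that] by linarith
  then show ?thesis
    using catalan_word_not_Nil[OF assms]
    by (auto simp: pattern_weight_def subword_occ_patterns_snoc[simplified])
qed

lemma pattern_weight_plateau:
  assumes "catalan_word w"
  shows "pattern_weight (w @ [last w]) = pattern_weight w"
proof -
  have "last w \<noteq> last (butlast w)" if "last_step w = Rise"
    using last_step_Rise[OF assms that] by linarith
  then show ?thesis
    using catalan_word_not_Nil[OF assms]
    by (auto simp: pattern_weight_def subword_occ_patterns_snoc[simplified])
qed

text \<open>There are \<open>excess w\<close> descents. After a plateau each completes 221; after a rise one completes 121
  and the others complete 231, which carries no weight; after a restart there are none.\<close>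

lemma pattern_weight_restarts:
  assumes "catalan_word w"
  shows "(\<Sum>b\<in>{run_start w..<last w}. pattern_weight (w @ [b])) =
    (case last_step w of Rise \<Rightarrow> of_nat (excess w) - 1 + q
       | Plateau \<Rightarrow> of_nat (excess w) * r | Restart \<Rightarrow> 0) * pattern_weight w"
proof -
  have nn: "w \<noteq> []"
    using assms by (rule catalan_word_not_Nil)
  show ?thesis
  proof (cases "last_step w")
    case Rise
    define s a where "s = run_start w" and "a = last w - 1"
    have a: "last w = Suc a" "s \<le> a"
      using last_step_Rise[OF assms Rise] by (auto simp: s_def a_def)
    have prev: "last (butlast w) = a"
      using last_step_Rise[OF assms Rise] by (simp add: a_def)
    have "(\<Sum>b\<in>{s..<Suc a}. pattern_weight (w @ [b])) =
        (\<Sum>b\<in>{s..<Suc a}. (if b = a then q else 1) * pattern_weight w)"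
      using nn Rise prev a
      by (intro sum.cong refl) (auto simp: pattern_weight_def subword_occ_patterns_snoc[simplified])
    also have "\<dots> = (of_nat (Suc a - s) - 1 + q) * pattern_weight w"
      using a by (simp add: sum_distrib_right[symmetric] Suc_diff_le algebra_simps)
    finally show ?thesis
      using Rise a by (simp add: s_def excess_def)
  next
    case Plateau
    have "(\<Sum>b\<in>{run_start w..<last w}. pattern_weight (w @ [b])) =
        (\<Sum>b\<in>{run_start w..<last w}. r * pattern_weight w)"
      using nn Plateau
      by (intro sum.cong refl) (auto simp: pattern_weight_def subword_occ_patterns_snoc[simplified])
    then show ?thesis
      using Plateau by (simp add: excess_def)
  next
    case Restart
    then show ?thesis
      using last_step_Restart[OF nn] by simp
  qed
qed

text \<open>The children of a word contribute one rise, one plateau and a bundle of descents; for each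
  prescribed last step only one of these three survives.\<close>

lemma step_sum_Suc:
  assumes "n > 0"
  shows "step_sum Rise f (Suc n) = step_sum Rise (\<lambda>t. f (Suc t)) n +
           p * step_sum Plateau (\<lambda>t. f (Suc t)) n + step_sum Restart (\<lambda>t. f (Suc t)) n"
    and "step_sum Plateau f (Suc n) = step_sum Rise f n + step_sum Plateau f n + step_sum Restart f n"
    and "step_sum Restart f (Suc n) =
           f 0 * (step_sum Rise (\<lambda>t. of_nat t - 1 + q) n + r * step_sum Plateau of_nat n)"
proof -
  have C: "catalan_word w" and nn: "w \<noteq> []" and le: "run_start w \<le> last w" if "w \<in> words n" for w
    using that catalan_word_not_Nil run_start_le_last
    by (auto simp: words_def flattened_catalan_words_def)
  show "step_sum Rise f (Suc n) = step_sum Rise (\<lambda>t. f (Suc t)) n +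
           p * step_sum Plateau (\<lambda>t. f (Suc t)) n + step_sum Restart (\<lambda>t. f (Suc t)) n"
    unfolding step_sum_def sum_words_Suc[OF assms] sum_distrib_left sum.distrib[symmetric]
  proof (intro sum.cong refl)
    fix w assume w: "w \<in> words n"
    show "(if last_step (w @ [Suc (last w)]) = Rise
          then f (excess (w @ [Suc (last w)])) * pattern_weight (w @ [Suc (last w)]) else 0) +
         (if last_step (w @ [last w]) = Rise
          then f (excess (w @ [last w])) * pattern_weight (w @ [last w]) else 0) +
         (\<Sum>b = run_start w..<last w. if last_step (w @ [b]) = Rise
            then f (excess (w @ [b])) * pattern_weight (w @ [b]) else 0) =
         (if last_step w = Rise then f (Suc (excess w)) * pattern_weight w else 0) +
         p * (if last_step w = Plateau then f (Suc (excess w)) * pattern_weight w else 0) +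
         (if last_step w = Restart then f (Suc (excess w)) * pattern_weight w else 0)"
      using nn[OF w] le[OF w] pattern_weight_rise[OF C[OF w]]
      by (cases "last_step w") (auto simp: last_step_snoc excess_def run_start_snoc Suc_diff_le)
  qed
  show "step_sum Plateau f (Suc n) = step_sum Rise f n + step_sum Plateau f n + step_sum Restart f n"
    unfolding step_sum_def sum_words_Suc[OF assms] sum.distrib[symmetric]
  proof (intro sum.cong refl)
    fix w assume w: "w \<in> words n"
    show "(if last_step (w @ [Suc (last w)]) = Plateau
          then f (excess (w @ [Suc (last w)])) * pattern_weight (w @ [Suc (last w)]) else 0) +
         (if last_step (w @ [last w]) = Plateau
          then f (excess (w @ [last w])) * pattern_weight (w @ [last w]) else 0) +
         (\<Sum>b = run_start w..<last w. if last_step (w @ [b]) = Plateau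
            then f (excess (w @ [b])) * pattern_weight (w @ [b]) else 0) =
         (if last_step w = Rise then f (excess w) * pattern_weight w else 0) +
         (if last_step w = Plateau then f (excess w) * pattern_weight w else 0) +
         (if last_step w = Restart then f (excess w) * pattern_weight w else 0)"
      using nn[OF w] le[OF w] pattern_weight_plateau[OF C[OF w]]
      by (cases "last_step w") (auto simp: last_step_snoc excess_def run_start_snoc)
  qed
  show "step_sum Restart f (Suc n) =
           f 0 * (step_sum Rise (\<lambda>t. of_nat t - 1 + q) n + r * step_sum Plateau of_nat n)"
    unfolding step_sum_def sum_words_Suc[OF assms] sum_distrib_left sum.distrib[symmetric]
  proof (intro sum.cong refl)
    fix w assume w: "w \<in> words n"
    have "(\<Sum>b = run_start w..<last w. if last_step (w @ [b]) = Restart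
            then f (excess (w @ [b])) * pattern_weight (w @ [b]) else 0) =
          f 0 * (\<Sum>b = run_start w..<last w. pattern_weight (w @ [b]))"
      unfolding sum_distrib_left using nn[OF w]
      by (intro sum.cong refl) (auto simp: last_step_snoc excess_def run_start_snoc)
    then show "(if last_step (w @ [Suc (last w)]) = Restart
          then f (excess (w @ [Suc (last w)])) * pattern_weight (w @ [Suc (last w)]) else 0) +
         (if last_step (w @ [last w]) = Restart
          then f (excess (w @ [last w])) * pattern_weight (w @ [last w]) else 0) +
         (\<Sum>b = run_start w..<last w. if last_step (w @ [b]) = Restart
            then f (excess (w @ [b])) * pattern_weight (w @ [b]) else 0) =
         f 0 * ((if last_step w = Rise
                 then (of_nat (excess w) - 1 + q) * pattern_weight w else 0) +
                r * (if last_step w = Plateau then of_nat (excess w) * pattern_weight w else 0))"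
      using nn[OF w] pattern_weight_restarts[OF C[OF w]]
      by (cases "last_step w") (auto simp: last_step_snoc algebra_simps)
  qed
qed

lemma step_gf_Rise:
  "step_gf Rise f = fps_X * (step_gf Rise (\<lambda>t. f (Suc t)) +
     fps_const p * step_gf Plateau (\<lambda>t. f (Suc t)) + step_gf Restart (\<lambda>t. f (Suc t)))"
proof (rule fps_ext)
  fix n
  show "fps_nth (step_gf Rise f) n = fps_nth (fps_X * (step_gf Rise (\<lambda>t. f (Suc t)) +
     fps_const p * step_gf Plateau (\<lambda>t. f (Suc t)) + step_gf Restart (\<lambda>t. f (Suc t)))) n"
  proof (cases n)
    case (Suc m)
    then show ?thesis
      by (cases "m = 0") (simp_all add: step_gf_def step_sum_0 step_sum_1 step_sum_Suc(1))
  qed (simp add: step_gf_def step_sum_0)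
qed

lemma step_gf_Plateau:
  "step_gf Plateau f = fps_X * (step_gf Rise f + step_gf Plateau f + step_gf Restart f)"
proof (rule fps_ext)
  fix n
  show "fps_nth (step_gf Plateau f) n =
    fps_nth (fps_X * (step_gf Rise f + step_gf Plateau f + step_gf Restart f)) n"
  proof (cases n)
    case (Suc m)
    then show ?thesis
      by (cases "m = 0") (simp_all add: step_gf_def step_sum_0 step_sum_1 step_sum_Suc(2))
  qed (simp add: step_gf_def step_sum_0)
qed

lemma step_gf_Restart:
  "step_gf Restart f = fps_const (f 0) * fps_X * (1 +
     step_gf Rise (\<lambda>t. of_nat t - 1 + q) + fps_const r * step_gf Plateau of_nat)"
proof (rule fps_ext)
  fix n
  show "fps_nth (step_gf Restart f) n = fps_nth (fps_const (f 0) * fps_X * (1 +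
     step_gf Rise (\<lambda>t. of_nat t - 1 + q) + fps_const r * step_gf Plateau of_nat)) n"
  proof (cases n)
    case (Suc m)
    then show ?thesis
      by (cases "m = 0")
        (simp_all add: step_gf_def step_sum_0 step_sum_1 step_sum_Suc(3) mult.assoc)
  qed (simp add: step_gf_def step_sum_0 mult.assoc)
qed

section \<open>Solving the linear system\<close>

lemma step_gf_add: "step_gf k (\<lambda>t. f t + g t) = step_gf k f + step_gf k g"
  by (rule fps_ext)
    (auto simp: step_gf_def step_sum_def sum.distrib[symmetric] algebra_simps intro!: sum.cong)

lemma sum_step_gf:
  "step_gf Rise f + step_gf Plateau f + step_gf Restart f =
     Abs_fps (\<lambda>n. \<Sum>w\<in>words n. f (excess w) * pattern_weight w)"
proof (rule fps_ext)
  fix n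
  have "(if last_step w = Rise then c else 0) + (if last_step w = Plateau then c else 0) +
      (if last_step w = Restart then c else 0) = c" for w and c :: 'a
    by (cases "last_step w") simp_all
  then show "fps_nth (step_gf Rise f + step_gf Plateau f + step_gf Restart f) n =
      fps_nth (Abs_fps (\<lambda>n. \<Sum>w\<in>words n. f (excess w) * pattern_weight w)) n"
    by (simp add: step_gf_def step_sum_def flip: sum.distrib)
qed

lemma step_gf_scale: "step_gf k (\<lambda>t. c * f t) = fps_const c * step_gf k f"
  by (rule fps_ext)
    (auto simp: step_gf_def step_sum_def sum_distrib_left algebra_simps intro!: sum.cong)

text \<open>A run that has just been opened has excess \<open>0\<close>.\<close>

lemma step_gf_Restart_multiple: "step_gf Restart f = fps_const (f 0) * step_gf Restart (\<lambda>_. 1)"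
  by (subst (1 2) step_gf_Restart) (simp add: mult.assoc)

text \<open>Elimination in the linear system for \<open>f = 1\<close> and \<open>f = t\<close>. Here \<open>V / (1 - X)\<close> is the factor for
  climbing one letter: a rise together with the plateaus before it, with a factor \<open>P\<close> if there are any.
  The series \<open>M = (1 - X) (1 - V / (1 - X))\<close> is the denominator produced by summing over the number
  of climbs. In the notation of the proof, \<open>A = V D / M\<close>, \<open>A' = V (1 - X) D / M^2\<close> and
  \<open>L' = X V D / M^2\<close>.\<close>

lemma restart_gf:
  defines "X \<equiv> fps_X :: 'a fps" and "P \<equiv> fps_const p" and "Q \<equiv> fps_const q" and "R \<equiv> fps_const r"
  defines "M \<equiv> 1 - 2 * X - (P - 1) * X ^ 2"
    and "V \<equiv> X * (1 + (P - 1) * X)"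
  shows "step_gf Restart (\<lambda>_. 1) * (M ^ 2 - X * V * (1 - X + (Q - 1) * M + R * X)) = X * M ^ 2"
proof -
  define D A L A' L' where
    "D = step_gf Restart (\<lambda>_. 1)" and "A = step_gf Rise (\<lambda>_. 1)" and "L = step_gf Plateau (\<lambda>_. 1)"
    and "A' = step_gf Rise of_nat" and "L' = step_gf Plateau of_nat"
  have L: "L = X * (A + L + D)"
    unfolding L_def A_def D_def X_def by (rule step_gf_Plateau)
  have A: "A = X * (A + P * L + D)"
    unfolding L_def A_def D_def X_def P_def by (rule step_gf_Rise)
  have D0: "step_gf Restart of_nat = 0"
    by (subst step_gf_Restart_multiple) simp
  have Suc_gf: "step_gf k (\<lambda>t. of_nat (Suc t)) = step_gf k (\<lambda>_. 1) + step_gf k of_nat" for k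
    by (simp add: step_gf_add[symmetric])
  have L': "L' = X * (A' + L')"
    using step_gf_Plateau[of of_nat] D0 unfolding L'_def A'_def X_def by simp
  have A': "A' = X * (A + A' + P * (L + L') + D)"
    using step_gf_Rise[of of_nat] unfolding Suc_gf D0
    by (simp add: A_def A'_def L_def L'_def D_def X_def P_def)
  have descents: "step_gf Rise (\<lambda>t. of_nat t - 1 + q) = A' + (Q - 1) * A"
    using step_gf_add[of Rise of_nat "\<lambda>_. (q - 1) * 1"] step_gf_scale[of Rise "q - 1" "\<lambda>_. 1"]
    by (simp add: A_def A'_def Q_def algebra_simps flip: fps_const_sub)
  have "D = X * (1 + step_gf Rise (\<lambda>t. of_nat t - 1 + q) + R * L')"
    using step_gf_Restart[of "\<lambda>_. 1"] by (simp add: D_def X_def R_def L'_def)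
  then have D: "D = X * (1 + A' + (Q - 1) * A + R * L')"
    unfolding descents by (simp only: add.assoc)
  have "fps_nth (1 - X) 0 \<noteq> 0"
    by (simp add: X_def)
  then have X1: "1 - X \<noteq> 0"
    by force
  have M: "M = 1 - X - V"
    by (simp add: M_def V_def algebra_simps power2_eq_square)
  have MA: "M * A = V * D"
    using L A unfolding M V_def by algebra
  have MA': "M * A' = V * (A + D)"
    using L A L' A' unfolding M V_def by algebra
  have MMA': "M ^ 2 * A' = V * (1 - X) * D"
    using MA MA' M by algebra
  have "(1 - X) * (M ^ 2 * L') = (1 - X) * (X * V * D)"
    using MMA' L' by algebra
  then have MML': "M ^ 2 * L' = X * V * D"
    using X1 by simp
  have "D * (M ^ 2 - X * V * (1 - X + (Q - 1) * M + R * X)) = X * M ^ 2"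
    using D MA MMA' MML' by algebra
  then show ?thesis by (simp add: D_def)
qed

text \<open>For \<open>f t = y ^ t\<close> the shift in \<open>step_gf_Rise\<close> is multiplication by \<open>y\<close>, so the equations for this
  \<open>f\<close> close up. Everything is a multiple of the series for the words that have just opened their
  last run, since such a run is continued by rises and plateaus only.\<close>

lemma total_gf:
  fixes y :: 'a
  defines "X \<equiv> fps_X :: 'a fps" and "P \<equiv> fps_const p" and "Y \<equiv> fps_const y"
  shows "(1 - X * (1 + Y) - (P - 1) * X ^ 2 * Y) *
    (step_gf Rise (\<lambda>t. y ^ t) + step_gf Plateau (\<lambda>t. y ^ t) + step_gf Restart (\<lambda>t. y ^ t)) =
    step_gf Restart (\<lambda>_. 1)"
proof -
  define D A L where
    "D = step_gf Restart (\<lambda>t. y ^ t)" and "A = step_gf Rise (\<lambda>t. y ^ t)"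
    and "L = step_gf Plateau (\<lambda>t. y ^ t)"
  have D: "D = step_gf Restart (\<lambda>_. 1)"
    unfolding D_def by (subst step_gf_Restart_multiple) simp
  have L: "L = X * (A + L + D)"
    unfolding L_def A_def D_def X_def by (rule step_gf_Plateau)
  have "A = X * (Y * A + P * (Y * L) + Y * D)"
    using step_gf_Rise[of "\<lambda>t. y ^ t"]
    unfolding A_def L_def D_def X_def P_def Y_def power_Suc step_gf_scale .
  then have A: "A = X * Y * (A + P * L + D)"
    by algebra
  \<comment> \<open>The equation for \<open>L\<close> expresses only \<open>(1 - X) * L\<close>, so the identity comes out multiplied by
    \<open>1 - X\<close>.\<close>
  have "fps_nth (1 - X) 0 \<noteq> 0"
    by (simp add: X_def)
  then have X1: "1 - X \<noteq> 0"
    by force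
  have "(1 - X) * ((1 - X * (1 + Y) - (P - 1) * X ^ 2 * Y) * (A + L + D)) = (1 - X) * D"
    using L A by algebra
  then have "(1 - X * (1 + Y) - (P - 1) * X ^ 2 * Y) * (A + L + D) = D"
    unfolding mult_left_cancel[OF X1] .
  then show ?thesis
    unfolding A_def L_def D_def D[unfolded D_def] .
qed

end

text \<open>Multiplying the equation of \<open>total_gf\<close> by \<open>\<alpha>\<close> turns its right-hand side into the numerator found in
  \<open>restart_gf\<close>, because \<open>\<alpha>\<close> is the second factor there, expanded in powers of \<open>X\<close>.\<close>

lemma sum_step_gf_rational:
  fixes y p q r :: "'a :: field"
  defines "X \<equiv> fps_X :: 'a fps" and "Y \<equiv> fps_const y"
    and "P \<equiv> fps_const p" and "Q \<equiv> fps_const q" and "R \<equiv> fps_const r"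
  defines "\<alpha> \<equiv> 1 - 4 * X - (2 * P + Q - 6) * X ^ 2 + (4 * P + 3 * Q - R - P * Q - 5) * X ^ 3
                 + (P - 1) * (P + 3 * Q - R - 3) * X ^ 4 + (P - 1) ^ 2 * (Q - 1) * X ^ 5"
  shows "step_gf p q r Rise (\<lambda>t. y ^ t) + step_gf p q r Plateau (\<lambda>t. y ^ t) +
           step_gf p q r Restart (\<lambda>t. y ^ t) =
         X * (1 - 2 * X - (P - 1) * X ^ 2) ^ 2 / ((1 - X * (1 + Y) - (P - 1) * X ^ 2 * Y) * \<alpha>)"
proof -
  define C where "C = step_gf p q r Rise (\<lambda>t. y ^ t) + step_gf p q r Plateau (\<lambda>t. y ^ t) +
    step_gf p q r Restart (\<lambda>t. y ^ t)"
  define D where "D = step_gf p q r Restart (\<lambda>_. 1)"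
  define M where "M = 1 - 2 * X - (P - 1) * X ^ 2"
  define E where "E = 1 - X * (1 + Y) - (P - 1) * X ^ 2 * Y"
  have \<alpha>: "\<alpha> = M ^ 2 - X * (X * (1 + (P - 1) * X)) * (1 - X + (Q - 1) * M + R * X)"
    unfolding \<alpha>_def M_def by algebra
  have D\<alpha>: "D * \<alpha> = X * M ^ 2"
    unfolding \<alpha> unfolding D_def M_def P_def Q_def R_def X_def by (rule restart_gf)
  have EC: "E * C = D"
    unfolding E_def C_def D_def P_def Y_def X_def by (rule total_gf)
  \<comment> \<open>Division of power series gives the expected quotient as soon as the denominator is nonzero and
    divides the numerator.\<close>
  have "fps_nth (E * \<alpha>) 0 = 1"
    by (simp add: E_def \<alpha> M_def X_def power2_eq_square)
  then have nz: "E * \<alpha> \<noteq> 0"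
    by force
  have "C * (E * \<alpha>) = X * M ^ 2"
    unfolding D\<alpha>[symmetric] EC[symmetric] by (simp only: mult_ac)
  then have "C = X * M ^ 2 / (E * \<alpha>)"
    using nonzero_mult_div_cancel_right[OF nz, of C] by simp
  then show ?thesis
    unfolding C_def M_def E_def .
qed

lemma to_fract_power: "to_fract (a ^ k) = to_fract a ^ k" for a :: "'a :: idom"
  by (induction k) simp_all

lemma catalan_gf_eq_step_gf:
  fixes y p q r :: "ypqr_poly fract"
  defines "y \<equiv> to_fract var_y" and "p \<equiv> to_fract var_p"
    and "q \<equiv> to_fract var_q" and "r \<equiv> to_fract var_r"
  shows "catalan_gf = step_gf p q r Rise (\<lambda>t. y ^ t) + step_gf p q r Plateau (\<lambda>t. y ^ t) +
           step_gf p q r Restart (\<lambda>t. y ^ t)"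
proof -
  have "to_fract (word_weight w) = y ^ excess w * pattern_weight p q r w" if "w \<in> words n" for w n
  proof -
    have "trun w - 1 = excess w"
      using that by (intro trun_minus_1) (simp add: words_def flattened_catalan_words_def)
    then show ?thesis
      by (simp only: word_weight_def pattern_weight_def y_def p_def q_def r_def
          to_fract_mult to_fract_power mult.assoc)
  qed
  then have "to_fract (\<Sum>w\<in>words n. word_weight w) =
      (\<Sum>w\<in>words n. y ^ excess w * pattern_weight p q r w)" for n
    unfolding to_fract_sum by (rule sum.cong[OF refl])
  moreover have "catalan_gf = Abs_fps (\<lambda>n. to_fract (\<Sum>w\<in>words n. word_weight w))"
    by (simp only: catalan_gf_def words_def)
  ultimately show ?thesis
    by (simp only: sum_step_gf)
qed

theorem theorem3p1:
  defines "x \<equiv> (fps_X :: ypqr_poly fract fps)"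
    and "y \<equiv> fps_const (to_fract var_y)"
    and "p \<equiv> fps_const (to_fract var_p)"
    and "q \<equiv> fps_const (to_fract var_q)"
    and "r \<equiv> fps_const (to_fract var_r)"
  defines "\<alpha> \<equiv> 1 - 4 * x - (2 * p + q - 6) * x ^ 2 + (4 * p + 3 * q - r - p * q - 5) * x ^ 3
                 + (p - 1) * (p + 3 * q - r - 3) * x ^ 4 + (p - 1) ^ 2 * (q - 1) * x ^ 5"
  shows "catalan_gf =
           x * (1 - 2 * x - (p - 1) * x ^ 2) ^ 2 / ((1 - x * (1 + y) - (p - 1) * x ^ 2 * y) * \<alpha>)"
  unfolding x_def y_def p_def q_def r_def \<alpha>_def catalan_gf_eq_step_gf
  by (rule sum_step_gf_rational)

end
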